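(* Let $H$ be the subgroup of $\ker j_*$ generated by $\sigma$, $h_\ell=\tau_\ell\sigma^{-1}\tau_\ell^{-1}$ and $h_m=\tau_m\sigma\tau_m^{-1}$. Then: (1) a word in the generators $\sigma,\tau_\ell,\tau_m$ of $\ker j_*$ represents an element of $H$ if and only if both the exponent sum of $\tau_\ell$ and the exponent sum of $\tau_m$ in the word are even; (2) the subgroup $H$ is a free group.
   Context: $M(1,2)$ and $M(1,0)$ are the mapping class groups of the torus with two punctures (which may be exchanged) and of the torus; $j_*\colon M(1,2)\to M(1,0)$ is the homomorphism forgetting the punctures. The group $\ker j_*$ is generated by $\sigma$ (a half-twist exchanging the two punctures), $\tau_\ell$ and $\tau_m$ (slides of one puncture around the longitude, resp. the meridian), with defining relations $$\tau_\ell\sigma^{-1}=\sigma\tau_\ell^{-1},\qquad \tau_m\sigma=\sigma^{-1}\tau_m^{-1},\qquad \sigma^2=\tau_m^{-1}\tau_\ell^{-1}\tau_m\tau_\ell .$$ Products of group elements are read left to right (the leftmost factor acts first). *)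

theory Defs
  imports "HOL-Analysis.Analysis" "HOL-Algebra.Generated_Groups" "HOL-Homology.Homology"
begin

section \<open>Words, presentations and free groups\<close>

text \<open>A letter \<open>(x, True)\<close> stands for the generator \<open>x\<close>, a letter \<open>(x, False)\<close> for its formal inverse.\<close>

type_synonym 'x word = "('x \<times> bool) list"

definition words :: "'x set \<Rightarrow> 'x word set"
  where "words X = {w. fst ` set w \<subseteq> X}"

fun word_val :: "('a, 'm) monoid_scheme \<Rightarrow> ('x \<Rightarrow> 'a) \<Rightarrow> 'x word \<Rightarrow> 'a"
  where
    "word_val G f [] = \<one>\<^bsub>G\<^esub>"
  | "word_val G f ((x, b) # w) = (if b then f x else inv\<^bsub>G\<^esub> f x) \<otimes>\<^bsub>G\<^esub> word_val G f w"

definition exp_sum :: "'x \<Rightarrow> 'x word \<Rightarrow> int"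
  where "exp_sum x w = (\<Sum>(y, b)\<leftarrow>w. if y = x then (if b then 1 else - 1) else 0)"

text \<open>Equality of words in the group \<open>\<langle>X | u = v for (u, v) \<in> R\<rangle>\<close>: the congruence
  generated by free cancellation and the relations \<open>R\<close>.\<close>

inductive pres_equiv :: "'x set \<Rightarrow> ('x word \<times> 'x word) set \<Rightarrow> 'x word \<Rightarrow> 'x word \<Rightarrow> bool"
  for X R where
    refl: "w \<in> words X \<Longrightarrow> pres_equiv X R w w"
  | sym: "pres_equiv X R u v \<Longrightarrow> pres_equiv X R v u"
  | trans: "pres_equiv X R u v \<Longrightarrow> pres_equiv X R v w \<Longrightarrow> pres_equiv X R u w"
  | in_context: "pres_equiv X R u v \<Longrightarrow> p \<in> words X \<Longrightarrow> q \<in> words X \<Longrightarrow> pres_equiv X R (p @ u @ q) (p @ v @ q)"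
  | cancel: "x \<in> X \<Longrightarrow> pres_equiv X R [(x, b), (x, \<not> b)] []"
  | relation: "(u, v) \<in> R \<Longrightarrow> pres_equiv X R u v"

text \<open>\<open>G\<close> is generated by the elements \<open>f x\<close> (\<open>x \<in> X\<close>) with defining relations \<open>R\<close>.\<close>

definition group_presentation ::
    "('a, 'm) monoid_scheme \<Rightarrow> 'x set \<Rightarrow> ('x \<Rightarrow> 'a) \<Rightarrow> ('x word \<times> 'x word) set \<Rightarrow> bool"
  where "group_presentation G X f R \<longleftrightarrow>
    group G \<and> f ` X \<subseteq> carrier G \<and> R \<subseteq> words X \<times> words X \<and>
    generate G (f ` X) = carrier G \<and>
    (\<forall>u\<in>words X. \<forall>v\<in>words X. word_val G f u = word_val G f v \<longleftrightarrow> pres_equiv X R u v)"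

text \<open>A group is free if it has a basis \<open>S\<close> (of arbitrary cardinality), i.e. a generating set
  between whose elements only the trivial relations hold.\<close>

definition free_group :: "('a, 'm) monoid_scheme \<Rightarrow> bool"
  where "free_group G \<longleftrightarrow> (\<exists>S\<subseteq>carrier G. group_presentation G S (\<lambda>s. s) {})"


section \<open>Mapping class groups of the punctured torus\<close>

definition torus :: "(complex \<times> complex) topology"
  where "torus = prod_topology (top_of_set (sphere 0 1)) (top_of_set (sphere 0 1))"

text \<open>Punctures are treated as marked points: the homeomorphisms preserve the set \<open>P\<close> of
  punctures but may permute it. Orientation is preserved iff the action on
  \<open>H\<^sub>2(T; \<int>) \<cong> \<int>\<close> is trivial. Maps are extensional (undefined off the torus),
  and the left factor of a product acts first.\<close>

definition homeo_group :: "(complex \<times> complex) set \<Rightarrow> (complex \<times> complex \<Rightarrow> complex \<times> complex) monoid"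
  where "homeo_group P =
    \<lparr>carrier = {f \<in> extensional (topspace torus).
        homeomorphic_map torus torus f \<and> f ` P = P \<and>
        (\<forall>c \<in> carrier (homology_group 2 torus). hom_induced 2 torus {} torus {} f c = c)},
     mult = (\<lambda>f g. compose (topspace torus) g f),
     one = (\<lambda>x\<in>topspace torus. x)\<rparr>"

text \<open>The homeomorphisms isotopic to the identity by an isotopy preserving \<open>P\<close> at all times.\<close>

definition isotopic_to_id :: "(complex \<times> complex) set \<Rightarrow> (complex \<times> complex \<Rightarrow> complex \<times> complex) set"
  where "isotopic_to_id P = {f \<in> carrier (homeo_group P).
    homotopic_with (\<lambda>h. homeomorphic_map torus torus h \<and> h ` P = P) torus torus f id}"

definition mapping_class_group :: "(complex \<times> complex) set \<Rightarrow> (complex \<times> complex \<Rightarrow> complex \<times> complex) set monoid"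
  where "mapping_class_group P = homeo_group P Mod isotopic_to_id P"

text \<open>Forgetting the punctures: the class of \<open>f\<close> relative to \<open>P\<close> is sent to the (larger) isotopy class
  of \<open>f\<close> as a homeomorphism of the closed torus; see \<open>forget_punctures_class\<close> below.\<close>

definition forget_punctures ::
    "(complex \<times> complex \<Rightarrow> complex \<times> complex) set \<Rightarrow> (complex \<times> complex \<Rightarrow> complex \<times> complex) set"
  where "forget_punctures C = isotopic_to_id {} <#>\<^bsub>homeo_group {}\<^esub> C"

definition forget_kernel :: "(complex \<times> complex) set \<Rightarrow> (complex \<times> complex \<Rightarrow> complex \<times> complex) set monoid"
  where "forget_kernel P = (mapping_class_group P)
    \<lparr>carrier := kernel (mapping_class_group P) (mapping_class_group {}) forget_punctures\<rparr>"

lemma carrier_homeoD: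
  assumes "f \<in> carrier (homeo_group P)"
  shows "f \<in> extensional (topspace torus)" "homeomorphic_map torus torus f" "f ` P = P"
    "continuous_map torus torus f" "f ` topspace torus = topspace torus"
    "\<And>x. x \<in> topspace torus \<Longrightarrow> f x \<in> topspace torus"
    "\<And>c. c \<in> carrier (homology_group 2 torus) \<Longrightarrow> hom_induced 2 torus {} torus {} f c = c"
proof -
  show "f \<in> extensional (topspace torus)" and h: "homeomorphic_map torus torus f" and "f ` P = P"
    and "\<And>c. c \<in> carrier (homology_group 2 torus) \<Longrightarrow> hom_induced 2 torus {} torus {} f c = c"
    using assms by (auto simp: homeo_group_def)
  show "continuous_map torus torus f" using h by (rule homeomorphic_imp_continuous_map)
  show im: "f ` topspace torus = topspace torus" using h by (rule homeomorphic_imp_surjective_map)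
  show "f x \<in> topspace torus" if "x \<in> topspace torus" for x using im that by blast
qed

lemma homeo_group_mult_closed:
  assumes P: "P \<subseteq> topspace torus" and f: "f \<in> carrier (homeo_group P)" and g: "g \<in> carrier (homeo_group P)"
  shows "compose (topspace torus) g f \<in> carrier (homeo_group P)"
proof -
  note F = carrier_homeoD[OF f] and G = carrier_homeoD[OF g]
  have eq: "\<And>x. x \<in> topspace torus \<Longrightarrow> (g \<circ> f) x = compose (topspace torus) g f x"
    by (simp add: compose_def)
  have 1: "homeomorphic_map torus torus (compose (topspace torus) g f)"
    using homeomorphic_map_compose[OF F(2) G(2)] eq by (rule homeomorphic_map_eq)
  have "compose (topspace torus) g f ` P = (g \<circ> f) ` P"
    using P eq by (intro image_cong) auto
  then have 2: "compose (topspace torus) g f ` P = P" using F(3) G(3) by (simp only: image_comp[symmetric])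
  have "hom_induced 2 torus {} torus {} (compose (topspace torus) g f) = hom_induced 2 torus {} torus {} (g \<circ> f)"
    using eq by (intro hom_induced_eq) auto
  also have "\<dots> = hom_induced 2 torus {} torus {} g \<circ> hom_induced 2 torus {} torus {} f"
    by (rule hom_induced_compose_empty[OF F(4) G(4)])
  finally show ?thesis using 1 2 F(7) G(7) by (simp add: homeo_group_def)
qed

lemma homeo_group_one_closed:
  assumes P: "P \<subseteq> topspace torus"
  shows "(\<lambda>x\<in>topspace torus. x) \<in> carrier (homeo_group P)"
proof -
  have 1: "homeomorphic_map torus torus (\<lambda>x\<in>topspace torus. x)"
    using homeomorphic_map_eq[of torus torus id] by simp
  have "(\<lambda>x\<in>topspace torus. x) ` P = (\<lambda>x. x) ` P" using P by (intro image_cong) auto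
  moreover have "hom_induced 2 torus {} torus {} (\<lambda>x\<in>topspace torus. x) c = c"
    if "c \<in> carrier (homology_group 2 torus)" for c
    by (rule hom_induced_id_gen) (use that homeomorphic_imp_continuous_map[OF 1] in auto)
  ultimately show ?thesis using 1 by (simp add: homeo_group_def)
qed

lemma homeo_group_inverse:
  assumes P: "P \<subseteq> topspace torus" and f: "f \<in> carrier (homeo_group P)"
  shows "\<exists>g\<in>carrier (homeo_group P). compose (topspace torus) f g = (\<lambda>x\<in>topspace torus. x)"
proof -
  note F = carrier_homeoD[OF f]
  obtain g' where g': "homeomorphic_maps torus torus f g'" using F(2) homeomorphic_map_maps by blast
  define g where "g = restrict g' (topspace torus)"
  have g: "homeomorphic_maps torus torus f g"
  proof (rule homeomorphic_maps_eq[OF g'])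
    show "\<And>y. y \<in> topspace torus \<Longrightarrow> g' y = g y" by (simp add: g_def)
  qed simp
  then have gh: "homeomorphic_map torus torus g"
    by (metis homeomorphic_map_maps homeomorphic_maps_sym)
  have gc: "continuous_map torus torus g" using gh homeomorphic_imp_continuous_map by blast
  have gf: "\<And>x. x \<in> topspace torus \<Longrightarrow> g (f x) = x" and fg: "\<And>x. x \<in> topspace torus \<Longrightarrow> f (g x) = x"
    using g by (auto simp: homeomorphic_maps_def)
  have "g ` P = g ` f ` P" using F(3) by simp
  also have "\<dots> = (\<lambda>x. x) ` P" unfolding image_image using P gf by (intro image_cong) auto
  also have "\<dots> = P" by simp
  finally have gP: "g ` P = P" .
  have "hom_induced 2 torus {} torus {} g c = c" if c: "c \<in> carrier (homology_group 2 torus)" for c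
  proof -
    have "hom_induced 2 torus {} torus {} g c = hom_induced 2 torus {} torus {} g (hom_induced 2 torus {} torus {} f c)"
      using F(7) c by simp
    also have "\<dots> = hom_induced 2 torus {} torus {} (g \<circ> f) c"
      using hom_induced_compose_empty[OF F(4) gc] by simp
    also have "\<dots> = c"
      by (rule hom_induced_id_gen[OF continuous_map_compose[OF F(4) gc] _ c]) (simp add: gf)
    finally show ?thesis .
  qed
  then have "g \<in> carrier (homeo_group P)" using gh gP by (simp add: homeo_group_def g_def)
  moreover have "compose (topspace torus) f g = (\<lambda>x\<in>topspace torus. x)"
    using fg by (auto simp: compose_def)
  ultimately show ?thesis by blast
qed

lemma group_homeo_group:
  assumes P: "P \<subseteq> topspace torus"
  shows "group (homeo_group P)"
proof (rule groupI)
  fix x y assume "x \<in> carrier (homeo_group P)" "y \<in> carrier (homeo_group P)"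
  then show "x \<otimes>\<^bsub>homeo_group P\<^esub> y \<in> carrier (homeo_group P)"
    using homeo_group_mult_closed[OF P] by (simp add: homeo_group_def)
next
  show "\<one>\<^bsub>homeo_group P\<^esub> \<in> carrier (homeo_group P)"
    using homeo_group_one_closed[OF P] by (simp add: homeo_group_def)
next
  fix x y z assume a: "x \<in> carrier (homeo_group P)" "y \<in> carrier (homeo_group P)" "z \<in> carrier (homeo_group P)"
  then have "compose (topspace torus) z (compose (topspace torus) y x) = compose (topspace torus) (compose (topspace torus) z y) x"
    using carrier_homeoD(6)[OF a(1)] by (auto simp: compose_def fun_eq_iff)
  then show "x \<otimes>\<^bsub>homeo_group P\<^esub> y \<otimes>\<^bsub>homeo_group P\<^esub> z = x \<otimes>\<^bsub>homeo_group P\<^esub> (y \<otimes>\<^bsub>homeo_group P\<^esub> z)"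
    by (simp add: homeo_group_def)
next
  fix x assume a: "x \<in> carrier (homeo_group P)"
  show "\<one>\<^bsub>homeo_group P\<^esub> \<otimes>\<^bsub>homeo_group P\<^esub> x = x"
    using carrier_homeoD(1)[OF a] by (auto simp: homeo_group_def compose_def fun_eq_iff extensional_def)
  show "\<exists>y\<in>carrier (homeo_group P). y \<otimes>\<^bsub>homeo_group P\<^esub> x = \<one>\<^bsub>homeo_group P\<^esub>"
    using homeo_group_inverse[OF P a] by (simp add: homeo_group_def)
qed

lemma isotopic_to_id_normal:
  assumes P: "P \<subseteq> topspace torus"
  shows "isotopic_to_id P \<lhd> homeo_group P"
proof -
  interpret G: group "homeo_group P" by (rule group_homeo_group[OF P])
  let ?Q = "\<lambda>h. homeomorphic_map torus torus h \<and> h ` P = P"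
  let ?I = "\<lambda>f. homotopic_with ?Q torus torus f id"
  have Qcomp: "?Q (h \<circ> k)" if "?Q h" "?Q k" for h k
    using that homeomorphic_map_compose[of torus torus k torus h] by (simp only: image_comp[symmetric] simp_thms)
  have ext: "?Q f \<longleftrightarrow> ?Q g" if "\<And>x. x \<in> topspace torus \<Longrightarrow> f x = g x" for f g
  proof -
    have "f ` P = g ` P" using that P by (intro image_cong) auto
    moreover have "homeomorphic_map torus torus f \<longleftrightarrow> homeomorphic_map torus torus g"
      using homeomorphic_map_eq[of torus torus f g, OF _ that] homeomorphic_map_eq[of torus torus g f, OF _ that[symmetric]] by blast
    ultimately show ?thesis by simp
  qed
  have Icong: "?I g" if "?I f" "\<And>x. x \<in> topspace torus \<Longrightarrow> f x = g x" for f g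
    by (rule homotopic_with_eq[OF that(1)]) (simp add: that(2), simp, rule ext)
  have left: "homotopic_with ?Q torus torus (h \<circ> f) (h \<circ> g)"
    if "homotopic_with ?Q torus torus f g" "?Q h" for f g h
    by (rule homotopic_with_compose_continuous_map_left[OF that(1)])
      (simp add: that(2) homeomorphic_imp_continuous_map, rule Qcomp[OF that(2)])
  have right: "homotopic_with ?Q torus torus (f \<circ> h) (g \<circ> h)"
    if "homotopic_with ?Q torus torus f g" "?Q h" for f g h
    by (rule homotopic_with_compose_continuous_map_right[OF that(1)])
      (simp add: that(2) homeomorphic_imp_continuous_map, rule Qcomp[OF _ that(2)])
  have Q: "?Q f" if "f \<in> carrier (homeo_group P)" for f using carrier_homeoD[OF that] by blast
  have mult: "x \<otimes>\<^bsub>homeo_group P\<^esub> y = compose (topspace torus) y x"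
    for x y :: "complex \<times> complex \<Rightarrow> complex \<times> complex" by (simp add: homeo_group_def)
  have Iid: "?I id"
    using homeomorphic_map_id by (auto simp: homotopic_with_refl)
  have sub: "subgroup (isotopic_to_id P) (homeo_group P)"
  proof (rule G.subgroupI)
    show "isotopic_to_id P \<subseteq> carrier (homeo_group P)" by (auto simp: isotopic_to_id_def)
    have "\<one>\<^bsub>homeo_group P\<^esub> \<in> isotopic_to_id P"
      using Icong[OF Iid, of "\<lambda>x\<in>topspace torus. x"] homeo_group_one_closed[OF P]
      by (simp add: isotopic_to_id_def) (simp add: homeo_group_def)
    then show "isotopic_to_id P \<noteq> {}" by blast
  next
    fix f assume "f \<in> isotopic_to_id P"
    then have f: "f \<in> carrier (homeo_group P)" and I: "?I f" by (auto simp: isotopic_to_id_def)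
    define g where "g = inv\<^bsub>homeo_group P\<^esub> f"
    have g: "g \<in> carrier (homeo_group P)" using f g_def by simp
    have "g \<otimes>\<^bsub>homeo_group P\<^esub> f = \<one>\<^bsub>homeo_group P\<^esub>" using f g_def by simp
    then have eq: "compose (topspace torus) f g = (\<lambda>x\<in>topspace torus. x)" by (simp add: homeo_group_def)
    have fg: "(f \<circ> g) x = id x" if "x \<in> topspace torus" for x
      using that fun_cong[OF eq, of x] by (simp add: compose_def)
    have "homotopic_with ?Q torus torus (f \<circ> g) (id \<circ> g)" using right[OF I Q[OF g]] .
    then have "homotopic_with ?Q torus torus g (f \<circ> g)" by (simp add: homotopic_with_symD)
    then have "?I g" 
      by (rule homotopic_with_eq) (simp, use fg in simp, rule ext)
    then show "inv\<^bsub>homeo_group P\<^esub> f \<in> isotopic_to_id P" using g by (simp add: isotopic_to_id_def g_def)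
  next
    fix f g assume "f \<in> isotopic_to_id P" "g \<in> isotopic_to_id P"
    then have f: "f \<in> carrier (homeo_group P)" "?I f" and g: "g \<in> carrier (homeo_group P)" "?I g"
      by (auto simp: isotopic_to_id_def)
    have "homotopic_with ?Q torus torus (g \<circ> f) (g \<circ> id)" using left[OF f(2) Q[OF g(1)]] .
    then have "?I (g \<circ> f)" using homotopic_with_trans[OF _ g(2)] by simp
    then have "?I (compose (topspace torus) g f)" by (rule Icong) (simp add: compose_def)
    then show "f \<otimes>\<^bsub>homeo_group P\<^esub> g \<in> isotopic_to_id P"
      using G.m_closed[OF f(1) g(1)] by (simp add: isotopic_to_id_def mult)
  qed
  show ?thesis
  proof (rule G.normal_invI[OF sub])
    fix x h assume x: "x \<in> carrier (homeo_group P)" and "h \<in> isotopic_to_id P"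
    then have h: "h \<in> carrier (homeo_group P)" "?I h" by (auto simp: isotopic_to_id_def)
    define y where "y = inv\<^bsub>homeo_group P\<^esub> x"
    have y: "y \<in> carrier (homeo_group P)" using x y_def by simp
    have "x \<otimes>\<^bsub>homeo_group P\<^esub> y = \<one>\<^bsub>homeo_group P\<^esub>" using x y_def by simp
    then have eq: "compose (topspace torus) y x = (\<lambda>x\<in>topspace torus. x)" by (simp add: homeo_group_def)
    have yx: "(y \<circ> id \<circ> x) z = id z" if "z \<in> topspace torus" for z
      using that fun_cong[OF eq, of z] by (simp add: compose_def)
    have "homotopic_with ?Q torus torus (y \<circ> h \<circ> x) (y \<circ> id \<circ> x)"
      by (rule right[OF left[OF h(2) Q[OF y]] Q[OF x]])
    then have "?I (compose (topspace torus) y (compose (topspace torus) h x))"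
      by (rule homotopic_with_eq) (simp add: compose_def, use yx in simp, rule ext)
    then show "x \<otimes>\<^bsub>homeo_group P\<^esub> h \<otimes>\<^bsub>homeo_group P\<^esub> inv\<^bsub>homeo_group P\<^esub> x \<in> isotopic_to_id P"
      using G.m_closed[OF G.m_closed[OF x h(1)] y] by (simp add: isotopic_to_id_def mult flip: y_def)
  qed
qed

lemma group_mapping_class_group: "P \<subseteq> topspace torus \<Longrightarrow> group (mapping_class_group P)"
  unfolding mapping_class_group_def by (intro normal.factorgroup_is_group isotopic_to_id_normal)

lemma carrier_homeo_group_mono: "carrier (homeo_group P) \<subseteq> carrier (homeo_group {})"
  by (auto simp: homeo_group_def)

lemma forget_punctures_class:
  assumes P: "P \<subseteq> topspace torus" and f: "f \<in> carrier (homeo_group P)"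
  shows "forget_punctures (isotopic_to_id P #>\<^bsub>homeo_group P\<^esub> f) = isotopic_to_id {} #>\<^bsub>homeo_group {}\<^esub> f"
proof -
  interpret N: normal "isotopic_to_id {}" "homeo_group {}" by (rule isotopic_to_id_normal) simp
  interpret NP: normal "isotopic_to_id P" "homeo_group P" by (rule isotopic_to_id_normal[OF P])
  have mult: "(\<otimes>\<^bsub>homeo_group P\<^esub>) = (\<otimes>\<^bsub>homeo_group {}\<^esub>)" by (simp add: homeo_group_def)
  have one: "\<one>\<^bsub>homeo_group P\<^esub> = \<one>\<^bsub>homeo_group {}\<^esub>" by (simp add: homeo_group_def)
  have le: "isotopic_to_id P \<subseteq> isotopic_to_id {}"
  proof
    fix h assume "h \<in> isotopic_to_id P"
    then have h: "h \<in> carrier (homeo_group P)"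
      "homotopic_with (\<lambda>h. homeomorphic_map torus torus h \<and> h ` P = P) torus torus h id"
      unfolding isotopic_to_id_def by blast+
    have "homotopic_with (\<lambda>h. homeomorphic_map torus torus h \<and> h ` {} = {}) torus torus h id"
      by (rule homotopic_with_mono[OF h(2)]) (elim conjE, intro conjI image_empty)
    then show "h \<in> isotopic_to_id {}"
      unfolding isotopic_to_id_def by (intro CollectI conjI subsetD[OF carrier_homeo_group_mono h(1)])
  qed
  have f0: "f \<in> carrier (homeo_group {})" by (rule subsetD[OF carrier_homeo_group_mono f])
  have "isotopic_to_id P #>\<^bsub>homeo_group P\<^esub> f = isotopic_to_id P #>\<^bsub>homeo_group {}\<^esub> f"
    by (simp only: r_coset_def mult)
  moreover have "isotopic_to_id {} <#>\<^bsub>homeo_group {}\<^esub> (isotopic_to_id P #>\<^bsub>homeo_group {}\<^esub> f)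
      = (isotopic_to_id {} <#>\<^bsub>homeo_group {}\<^esub> isotopic_to_id P) #>\<^bsub>homeo_group {}\<^esub> f"
    by (rule N.setmult_rcos_assoc) (rule N.subset, rule subset_trans[OF le N.subset], rule f0)
  moreover have "isotopic_to_id {} <#>\<^bsub>homeo_group {}\<^esub> isotopic_to_id P = isotopic_to_id {}"
  proof
    show "isotopic_to_id {} <#>\<^bsub>homeo_group {}\<^esub> isotopic_to_id P \<subseteq> isotopic_to_id {}"
    proof
      fix h assume "h \<in> isotopic_to_id {} <#>\<^bsub>homeo_group {}\<^esub> isotopic_to_id P"
      then obtain a b where "a \<in> isotopic_to_id {}" "b \<in> isotopic_to_id P" "h = a \<otimes>\<^bsub>homeo_group {}\<^esub> b"
        unfolding set_mult_def by blast
      then show "h \<in> isotopic_to_id {}"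
        using le subgroup.m_closed[OF N.subgroup_axioms, of a b] by (simp only: subsetD)
    qed
    have "\<one>\<^bsub>homeo_group {}\<^esub> \<in> isotopic_to_id P"
      using subgroup.one_closed[OF NP.subgroup_axioms] unfolding one .
    then show "isotopic_to_id {} \<subseteq> isotopic_to_id {} <#>\<^bsub>homeo_group {}\<^esub> isotopic_to_id P"
    proof -
      assume one: "\<one>\<^bsub>homeo_group {}\<^esub> \<in> isotopic_to_id P"
      show ?thesis
      proof
        fix h assume h: "h \<in> isotopic_to_id {}"
        then have "h \<otimes>\<^bsub>homeo_group {}\<^esub> \<one>\<^bsub>homeo_group {}\<^esub> = h" by (intro N.r_one subsetD[OF N.subset])
        then show "h \<in> isotopic_to_id {} <#>\<^bsub>homeo_group {}\<^esub> isotopic_to_id P"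
          unfolding set_mult_def using h one by force
      qed
    qed
  qed
  ultimately show ?thesis by (simp only: forget_punctures_def)
qed

lemma forget_punctures_hom:
  assumes P: "P \<subseteq> topspace torus"
  shows "forget_punctures \<in> hom (mapping_class_group P) (mapping_class_group {})"
proof -
  interpret N: normal "isotopic_to_id {}" "homeo_group {}" by (rule isotopic_to_id_normal) simp
  interpret NP: normal "isotopic_to_id P" "homeo_group P" by (rule isotopic_to_id_normal[OF P])
  have mult: "(\<otimes>\<^bsub>homeo_group P\<^esub>) = (\<otimes>\<^bsub>homeo_group {}\<^esub>)" by (simp add: homeo_group_def)
  have c: "x \<in> carrier (homeo_group P) \<Longrightarrow> x \<in> carrier (homeo_group {})" for x
    by (rule subsetD[OF carrier_homeo_group_mono])
  show ?thesis
  proof (rule homI)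
    fix C assume "C \<in> carrier (mapping_class_group P)"
    then obtain f where f: "f \<in> carrier (homeo_group P)" "C = isotopic_to_id P #>\<^bsub>homeo_group P\<^esub> f"
      by (auto simp: mapping_class_group_def FactGroup_def RCOSETS_def)
    then show "forget_punctures C \<in> carrier (mapping_class_group {})"
      using c forget_punctures_class[OF P] by (auto simp: mapping_class_group_def FactGroup_def RCOSETS_def)
  next
    fix C D assume "C \<in> carrier (mapping_class_group P)" "D \<in> carrier (mapping_class_group P)"
    then obtain f g where f: "f \<in> carrier (homeo_group P)" "C = isotopic_to_id P #>\<^bsub>homeo_group P\<^esub> f"
      and g: "g \<in> carrier (homeo_group P)" "D = isotopic_to_id P #>\<^bsub>homeo_group P\<^esub> g"
      by (auto simp: mapping_class_group_def FactGroup_def RCOSETS_def)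
    show "forget_punctures (C \<otimes>\<^bsub>mapping_class_group P\<^esub> D) = forget_punctures C \<otimes>\<^bsub>mapping_class_group {}\<^esub> forget_punctures D"
      using f g c forget_punctures_class[OF P] NP.rcos_sum N.rcos_sum
      by (simp add: mapping_class_group_def FactGroup_def) (simp add: mult)
  qed
qed

lemma group_forget_kernel:
  assumes "P \<subseteq> topspace torus"
  shows "group (forget_kernel P)"
proof -
  interpret group_hom "mapping_class_group P" "mapping_class_group {}" forget_punctures
    using assms by (intro group_hom.intro group_hom_axioms.intro group_mapping_class_group forget_punctures_hom) auto
  show ?thesis
    unfolding forget_kernel_def using G.subgroup_imp_group[OF subgroup_kernel] .
qed


section \<open>The presentation of the kernel and the subgroup \<open>H\<close>\<close>

datatype gen = Sigma | TauL | TauM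

fun gen_interp :: "'a \<Rightarrow> 'a \<Rightarrow> 'a \<Rightarrow> gen \<Rightarrow> 'a"
  where
    "gen_interp \<sigma> \<tau>\<^sub>l \<tau>\<^sub>m Sigma = \<sigma>"
  | "gen_interp \<sigma> \<tau>\<^sub>l \<tau>\<^sub>m TauL = \<tau>\<^sub>l"
  | "gen_interp \<sigma> \<tau>\<^sub>l \<tau>\<^sub>m TauM = \<tau>\<^sub>m"

definition kernel_relations :: "(gen word \<times> gen word) set"
  where "kernel_relations =
    {([(TauL, True), (Sigma, False)], [(Sigma, True), (TauL, False)]),
     ([(TauM, True), (Sigma, True)], [(Sigma, False), (TauM, False)]),
     ([(Sigma, True), (Sigma, True)], [(TauM, False), (TauL, False), (TauM, True), (TauL, True)])}"

definition subgroup_H :: "('a, 'm) monoid_scheme \<Rightarrow> 'a \<Rightarrow> 'a \<Rightarrow> 'a \<Rightarrow> 'a set"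
  where "subgroup_H G \<sigma> \<tau>\<^sub>l \<tau>\<^sub>m = generate G
    {\<sigma>,
     \<tau>\<^sub>l \<otimes>\<^bsub>G\<^esub> inv\<^bsub>G\<^esub> \<sigma> \<otimes>\<^bsub>G\<^esub> inv\<^bsub>G\<^esub> \<tau>\<^sub>l,
     \<tau>\<^sub>m \<otimes>\<^bsub>G\<^esub> \<sigma> \<otimes>\<^bsub>G\<^esub> inv\<^bsub>G\<^esub> \<tau>\<^sub>m}"

end

theory Submission
  imports Defs
begin

text \<open>The parities of the exponent sums of \<open>\<tau>\<^sub>l\<close> and \<open>\<tau>\<^sub>m\<close> define a homomorphism onto
  \<open>\<int>/2 \<times> \<int>/2\<close>, and \<open>1, \<tau>\<^sub>l, \<tau>\<^sub>m, \<tau>\<^sub>l \<tau>\<^sub>m\<close> is a Schreier transversal of its kernel. The Schreier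
  rewriting process, with all output simplified to words in \<open>\<sigma>, h\<^sub>l, h\<^sub>m\<close>, shows that these three
  elements generate the kernel. It also respects the three defining relations up to free
  cancellation, and it is inverse to substituting \<open>\<sigma>, h\<^sub>l, h\<^sub>m\<close> into a word; hence there is no
  nontrivial relation between them.\<close>

section \<open>Words\<close>

definition inv_word :: "'x word \<Rightarrow> 'x word"
  where "inv_word w = rev (map (apsnd Not) w)"

definition subst_word :: "('x \<Rightarrow> 'y word) \<Rightarrow> 'x word \<Rightarrow> 'y word"
  where "subst_word e w = concat (map (\<lambda>(x, b). if b then e x else inv_word (e x)) w)"

lemma words_simps [simp]:
  "[] \<in> words X"
  "(x, b) # w \<in> words X \<longleftrightarrow> x \<in> X \<and> w \<in> words X"
  "u @ v \<in> words X \<longleftrightarrow> u \<in> words X \<and> v \<in> words X"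
  "w \<in> words UNIV"
  by (auto simp: words_def)

lemma inv_word_simps [simp]:
  "inv_word [] = []"
  "inv_word ((x, b) # w) = inv_word w @ [(x, \<not> b)]"
  "inv_word (u @ v) = inv_word v @ inv_word u"
  "inv_word (inv_word w) = w"
  by (auto simp: inv_word_def rev_map intro: map_idI)

lemma inv_word_in_words [simp]: "inv_word w \<in> words X \<longleftrightarrow> w \<in> words X"
  by (force simp: inv_word_def words_def)

lemma subst_word_simps [simp]:
  "subst_word e [] = []"
  "subst_word e ((x, b) # w) = (if b then e x else inv_word (e x)) @ subst_word e w"
  by (simp_all add: subst_word_def)

lemma pres_equiv_append:
  assumes "pres_equiv X R u u'" "pres_equiv X R v v'" "u' \<in> words X" "v \<in> words X"
  shows "pres_equiv X R (u @ v) (u' @ v')"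
  using pres_equiv.in_context[OF assms(1), of "[]" v] pres_equiv.in_context[OF assms(2), of u' "[]"]
    assms(3,4) by (auto intro: pres_equiv.trans)

lemma pres_equiv_inv_word:
  assumes "w \<in> words X"
  shows "pres_equiv X R (w @ inv_word w) []"
  using assms
proof (induction w)
  case Nil
  then show ?case by (simp add: pres_equiv.refl)
next
  case (Cons a w)
  obtain x b where a: "a = (x, b)" by force
  have "pres_equiv X R ([(x, b)] @ (w @ inv_word w) @ [(x, \<not> b)]) ([(x, b)] @ [] @ [(x, \<not> b)])"
    using Cons a by (intro pres_equiv.in_context) auto
  then show ?case
    using Cons.prems a pres_equiv.cancel[of x X R b] by (auto intro: pres_equiv.trans)
qed

text \<open>Used to pass from words over an index set to words over the elements that the indices
  name. The map may identify letters, since cancelling pairs stay cancelling pairs.\<close>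

lemma pres_equiv_map:
  assumes "pres_equiv X {} u v"
  shows "pres_equiv (f ` X) {} (map (apfst f) u) (map (apfst f) v)"
  using assms
proof induction
  case (refl w)
  then show ?case by (intro pres_equiv.refl) (force simp: words_def)
next
  case (in_context u v p q)
  then have "map (apfst f) p \<in> words (f ` X)" "map (apfst f) q \<in> words (f ` X)"
    by (force simp: words_def)+
  with in_context show ?case by (simp add: pres_equiv.in_context)
qed (auto intro: pres_equiv.intros)

section \<open>Free reduction of words\<close>

fun reduce_cons :: "'x \<times> bool \<Rightarrow> 'x word \<Rightarrow> 'x word"
  where
    "reduce_cons a [] = [a]"
  | "reduce_cons a (c # w) = (if fst a = fst c \<and> snd a \<noteq> snd c then w else a # c # w)"

definition reduce_word :: "'x word \<Rightarrow> 'x word"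
  where "reduce_word w = foldr reduce_cons w []"

lemma pres_equiv_reduce_cons:
  assumes "fst a \<in> X" "w \<in> words X"
  shows "pres_equiv X R (a # w) (reduce_cons a w) \<and> reduce_cons a w \<in> words X"
proof (cases w)
  case Nil
  with assms show ?thesis by (cases a) (simp add: pres_equiv.refl)
next
  case (Cons c v)
  have "pres_equiv X R ([] @ [a, c] @ v) ([] @ [] @ v)" if "fst a = fst c" "snd a \<noteq> snd c"
    using that assms Cons pres_equiv.cancel[of "fst a" X R "snd a"]
    by (cases a; cases c; intro pres_equiv.in_context) auto
  with assms Cons show ?thesis by (cases a; cases c) (auto intro: pres_equiv.refl)
qed

lemma pres_equiv_reduce_word:
  assumes "w \<in> words X"
  shows "pres_equiv X R w (reduce_word w) \<and> reduce_word w \<in> words X"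
  using assms
proof (induction w)
  case Nil
  then show ?case by (simp add: reduce_word_def pres_equiv.refl)
next
  case (Cons a w)
  then have "pres_equiv X R ([a] @ w @ []) ([a] @ reduce_word w @ [])"
    by (intro pres_equiv.in_context) (cases a; auto)+
  moreover have "reduce_word (a # w) = reduce_cons a (reduce_word w)" by (simp add: reduce_word_def)
  ultimately show ?case
    using pres_equiv_reduce_cons[of a X "reduce_word w"] Cons
    by (cases a) (auto intro: pres_equiv.trans)
qed

text \<open>Turns claims about concrete words into evaluations of \<open>reduce_word\<close>, as in
  the finite checks of the rewriting table.\<close>

lemma pres_equiv_if_reduce_word_eq:
  assumes "reduce_word u = reduce_word v" "u \<in> words X" "v \<in> words X"
  shows "pres_equiv X R u v"
  using assms pres_equiv_reduce_word by (metis pres_equiv.sym pres_equiv.trans)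

section \<open>Values of words\<close>

lemma (in group) word_val_closed [intro, simp]:
  assumes "f ` X \<subseteq> carrier G" "w \<in> words X"
  shows "word_val G f w \<in> carrier G"
  using assms(2)
proof (induction w)
  case (Cons a w)
  with assms(1) show ?case by (cases a) auto
qed simp

lemma (in group) word_val_append:
  assumes "f ` X \<subseteq> carrier G" "u \<in> words X" "v \<in> words X"
  shows "word_val G f (u @ v) = word_val G f u \<otimes> word_val G f v"
  using assms(2)
proof (induction u)
  case Nil
  with assms show ?case by (simp add: word_val_closed[OF assms(1)])
next
  case (Cons a u)
  obtain x b where a: "a = (x, b)" by force
  then have "f x \<in> carrier G" using Cons.prems assms(1) by auto
  then show ?case
    using Cons a assms(3) by (simp add: m_assoc word_val_closed[OF assms(1)])
qed

lemma (in group) word_val_inv_word: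
  assumes "f ` X \<subseteq> carrier G" "w \<in> words X"
  shows "word_val G f (inv_word w) = inv (word_val G f w)"
  using assms(2)
proof (induction w)
  case (Cons a w)
  obtain x b where a: "a = (x, b)" by force
  then have "f x \<in> carrier G" using Cons.prems assms(1) by auto
  then show ?case
    using Cons a
    by (auto simp: word_val_append[OF assms(1)] word_val_closed[OF assms(1)] inv_mult_group)
qed simp

lemma (in group) word_val_subst_word:
  assumes "range f \<subseteq> carrier G"
  shows "word_val G f (subst_word e w) = word_val G (\<lambda>x. word_val G f (e x)) w"
proof (induction w)
  case (Cons a w)
  then show ?case
    by (cases a) (simp add: word_val_append[OF assms] word_val_inv_word[OF assms])
qed simp

lemma (in group) word_val_pres_equiv:
  assumes "pres_equiv X {} u v" "f ` X \<subseteq> carrier G"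
  shows "word_val G f u = word_val G f v"
proof -
  \<comment> \<open>Membership in \<open>words X\<close> is carried along because
    \<open>word_val_append\<close> requires it.\<close>
  have "u \<in> words X \<and> v \<in> words X \<and> word_val G f u = word_val G f v"
    using assms(1)
  proof induction
    case (in_context u v p q)
    then show ?case by (simp add: word_val_append[OF assms(2)])
  next
    case (cancel x b)
    then have "f x \<in> carrier G" using assms(2) by auto
    with cancel show ?case by simp
  qed auto
  then show ?thesis by blast
qed

lemma (in group) generate_eq_word_val:
  assumes "f ` X \<subseteq> carrier G"
  shows "generate G (f ` X) = word_val G f ` words X"
proof
  show "generate G (f ` X) \<subseteq> word_val G f ` words X"
  proof
    fix g assume "g \<in> generate G (f ` X)"
    then show "g \<in> word_val G f ` words X"
    proof induction
      case one
      show ?case by (rule image_eqI[of _ _ "[]"]) auto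
    next
      case (incl g)
      then obtain x where "x \<in> X" "g = f x" by blast
      then show ?case using assms by (intro image_eqI[of _ _ "[(x, True)]"]) auto
    next
      case (inv g)
      then obtain x where "x \<in> X" "g = f x" by blast
      then show ?case using assms by (intro image_eqI[of _ _ "[(x, False)]"]) auto
    next
      case (eng g h)
      then obtain u v where "u \<in> words X" "g = word_val G f u" "v \<in> words X" "h = word_val G f v"
        by blast
      then show ?case using word_val_append[OF assms] by (intro image_eqI[of _ _ "u @ v"]) auto
    qed
  qed
  have "word_val G f w \<in> generate G (f ` X)" if "w \<in> words X" for w
    using that
  proof (induction w)
    case Nil
    show ?case by (simp add: generate.one)
  next
    case (Cons a w)
    then show ?case
      by (cases a) (auto intro!: generate.eng intro: generate.incl generate.inv)
  qed
  then show "word_val G f ` words X \<subseteq> generate G (f ` X)" by blast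
qed

lemma (in group) word_val_subgroup:
  assumes "subgroup H G" "f ` X \<subseteq> H" "w \<in> words X"
  shows "word_val (G\<lparr>carrier := H\<rparr>) f w = word_val G f w"
  using assms(3)
proof (induction w)
  case (Cons a w)
  then show ?case
    using assms(1,2) by (cases a) (auto simp: m_inv_consistent)
qed simp

lemma word_val_map: "word_val G (\<lambda>x. x) (map (apfst f) w) = word_val G f w"
proof (induction w)
  case (Cons a w)
  then show ?case by (cases a) simp
qed simp

text \<open>The basis is the image of \<open>X\<close> under \<open>f\<close>. Words over it are
  lifted letter by letter to \<open>X\<close>, compared there, and mapped back.\<close>

lemma free_group_if_presentation:
  assumes "group_presentation G X f {}"
  shows "free_group G"
proof -
  interpret group G using assms by (simp add: group_presentation_def)
  have f: "f ` X \<subseteq> carrier G" and gen: "generate G (f ` X) = carrier G"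
    and eq: "\<And>u v. u \<in> words X \<Longrightarrow> v \<in> words X \<Longrightarrow>
      word_val G f u = word_val G f v \<Longrightarrow> pres_equiv X {} u v"
    using assms by (auto simp: group_presentation_def)
  have lift: "\<exists>w'\<in>words X. w = map (apfst f) w'" if "w \<in> words (f ` X)" for w
    using that
  proof (induction w)
    case (Cons a w)
    then obtain x w' where "a = (f x, snd a)" "x \<in> X" "w' \<in> words X" "w = map (apfst f) w'"
      by (cases a) auto
    then show ?case by (intro bexI[of _ "(x, snd a) # w'"]) auto
  qed (auto intro!: bexI[of _ "[]"])
  have "word_val G (\<lambda>s. s) u = word_val G (\<lambda>s. s) v \<longleftrightarrow> pres_equiv (f ` X) {} u v"
    if uv: "u \<in> words (f ` X)" "v \<in> words (f ` X)" for u v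
  proof
    assume val: "word_val G (\<lambda>s. s) u = word_val G (\<lambda>s. s) v"
    obtain u' v' where "u' \<in> words X" "v' \<in> words X" "u = map (apfst f) u'" "v = map (apfst f) v'"
      using uv lift by metis
    then show "pres_equiv (f ` X) {} u v" using val eq pres_equiv_map by (metis word_val_map)
  next
    assume "pres_equiv (f ` X) {} u v"
    then show "word_val G (\<lambda>s. s) u = word_val G (\<lambda>s. s) v"
      using f by (intro word_val_pres_equiv[of "f ` X"]) auto
  qed
  then have "group_presentation G (f ` X) (\<lambda>s. s) {}"
    using f gen is_group by (simp add: group_presentation_def)
  with f show ?thesis unfolding free_group_def by blast
qed

section \<open>Schreier rewriting\<close>

text \<open>Letters \<open>Sigma\<close>, \<open>TauL\<close>, \<open>TauM\<close> of output words stand for \<open>\<sigma>\<close>, \<open>h\<^sub>l\<close>, \<open>h\<^sub>m\<close>.\<close>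

fun H_word :: "gen \<Rightarrow> gen word"
  where
    "H_word Sigma = [(Sigma, True)]"
  | "H_word TauL = [(TauL, True), (Sigma, False), (TauL, False)]"
  | "H_word TauM = [(TauM, True), (Sigma, True), (TauM, False)]"

text \<open>A state holds the parities of the exponent sums of \<open>\<tau>\<^sub>l\<close> and
  \<open>\<tau>\<^sub>m\<close>, with \<open>True\<close> for odd.\<close>

fun coset_step :: "bool \<times> bool \<Rightarrow> gen \<Rightarrow> bool \<times> bool"
  where
    "coset_step (i, j) Sigma = (i, j)"
  | "coset_step (i, j) TauL = (\<not> i, j)"
  | "coset_step (i, j) TauM = (i, \<not> j)"

fun coset_rep :: "bool \<times> bool \<Rightarrow> gen word"
  where "coset_rep (i, j) = (if i then [(TauL, True)] else []) @ (if j then [(TauM, True)] else [])"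

text \<open>The Schreier generator \<open>r x r'\<inverse>\<close>, where \<open>r\<close> represents the coset \<open>q\<close> and \<open>r'\<close> the coset of
  \<open>r x\<close>. The word for \<open>x = \<sigma>\<close> and \<open>r = \<tau>\<^sub>l \<tau>\<^sub>m\<close> is \<open>h\<^sub>m\<inverse> \<sigma>\<inverse> h\<^sub>l\<close>.\<close>

fun schreier_gen :: "bool \<times> bool \<Rightarrow> gen \<Rightarrow> gen word"
  where
    "schreier_gen (False, False) Sigma = [(Sigma, True)]"
  | "schreier_gen (False, False) TauL = []"
  | "schreier_gen (False, False) TauM = []"
  | "schreier_gen (True, False) Sigma = [(TauL, False)]"
  | "schreier_gen (True, False) TauL = [(TauL, False), (Sigma, True)]"
  | "schreier_gen (True, False) TauM = []"
  | "schreier_gen (False, True) Sigma = [(TauM, True)]"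
  | "schreier_gen (False, True) TauL =
      [(TauM, False), (Sigma, False), (TauL, True), (TauM, False), (Sigma, False), (TauL, True)]"
  | "schreier_gen (False, True) TauM = [(TauM, False), (Sigma, False)]"
  | "schreier_gen (True, True) Sigma = [(TauM, False), (Sigma, False), (TauL, True)]"
  | "schreier_gen (True, True) TauL = [(TauL, False), (Sigma, True), (TauM, True), (TauM, True)]"
  | "schreier_gen (True, True) TauM = [(TauL, False), (Sigma, True), (TauM, True), (TauL, True)]"

text \<open>The cosets form an elementary abelian 2-group, so \<open>x\<close> and \<open>x\<inverse>\<close> act on them in the same way.\<close>

fun coset_run :: "bool \<times> bool \<Rightarrow> gen word \<Rightarrow> bool \<times> bool"
  where
    "coset_run q [] = q"
  | "coset_run q ((x, b) # w) = coset_run (coset_step q x) w"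

text \<open>An inverse letter read at \<open>q\<close> runs backwards along the edge from
  \<open>coset_step q x\<close> to \<open>q\<close>, so it contributes the inverse of the Schreier
  generator of that edge.\<close>

fun rewrite_word :: "bool \<times> bool \<Rightarrow> gen word \<Rightarrow> gen word"
  where
    "rewrite_word q [] = []"
  | "rewrite_word q ((x, b) # w) =
      (if b then schreier_gen q x else inv_word (schreier_gen (coset_step q x) x))
      @ rewrite_word (coset_step q x) w"

lemma coset_step_step [simp]: "coset_step (coset_step q x) x = q"
  by (cases q; cases x) auto

lemma coset_run_append [simp]: "coset_run q (u @ v) = coset_run (coset_run q u) v"
  by (induction q u rule: coset_run.induct) auto

lemma rewrite_word_append [simp]:
  "rewrite_word q (u @ v) = rewrite_word q u @ rewrite_word (coset_run q u) v"
  by (induction q u rule: rewrite_word.induct) auto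

text \<open>Each letter flips at most one parity; \<open>\<noteq>\<close> on booleans is addition
  modulo 2.\<close>

lemma coset_run_eq:
  "coset_run (i, j) w = (i \<noteq> odd (exp_sum TauL w), j \<noteq> odd (exp_sum TauM w))"
proof (induction w arbitrary: i j)
  case Nil
  show ?case by (simp add: exp_sum_def)
next
  case (Cons a w)
  obtain x b where "a = (x, b)" by force
  with Cons show ?case by (cases x) (auto simp: exp_sum_def)
qed

text \<open>A relation may follow a prefix leading to any coset, so each of the three is checked
  from all four states by free reduction.\<close>

lemma rewrite_word_kernel_relations:
  assumes "(u, v) \<in> kernel_relations"
  shows "coset_run q u = coset_run q v \<and> pres_equiv UNIV {} (rewrite_word q u) (rewrite_word q v)"
proof -
  have "coset_run (i, j) u = coset_run (i, j) v \<and>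
      reduce_word (rewrite_word (i, j) u) = reduce_word (rewrite_word (i, j) v)" for i j
    using assms by (cases i; cases j) (auto simp: kernel_relations_def reduce_word_def)
  then show ?thesis by (cases q) (simp add: pres_equiv_if_reduce_word_eq)
qed

text \<open>Rewriting descends to the presented group. Equality of the final states ensures that a
  common suffix is rewritten identically.\<close>

lemma rewrite_word_pres_equiv:
  assumes "pres_equiv UNIV kernel_relations u v"
  shows "coset_run q u = coset_run q v \<and> pres_equiv UNIV {} (rewrite_word q u) (rewrite_word q v)"
  using assms
proof (induction arbitrary: q)
  case (in_context u v p w)
  let ?q = "coset_run q p"
  have "coset_run ?q u = coset_run ?q v"
    and "pres_equiv UNIV {} (rewrite_word ?q u) (rewrite_word ?q v)"
    using in_context.IH by blast+
  then show ?case by (simp add: pres_equiv.in_context)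
next
  \<comment> \<open>The two instances cover a letter before its inverse and an inverse before its
    letter; by \<open>coset_step_step\<close> both factors use the same Schreier generator.\<close>
  case (cancel x b)
  show ?case
    using pres_equiv_inv_word[of "schreier_gen q x" UNIV "{}"]
      pres_equiv_inv_word[of "inv_word (schreier_gen (coset_step q x) x)" UNIV "{}"]
    by auto
next
  case (relation u v)
  then show ?case by (rule rewrite_word_kernel_relations)
next
  case (trans u v w)
  then show ?case by (metis pres_equiv.trans)
qed (auto intro: pres_equiv.intros)

text \<open>Each \<open>H_word x\<close> is a loop at the trivial coset whose rewriting is the
  single letter \<open>x\<close>. Rewriting is thus a left inverse of substitution, the source of
  freeness.\<close>

lemma rewrite_subst_H_word:
  "coset_run (False, False) (subst_word H_word w) = (False, False) \<and>
   pres_equiv UNIV {} (rewrite_word (False, False) (subst_word H_word w)) w"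
proof (induction w)
  case Nil
  show ?case by (simp add: pres_equiv.refl)
next
  case (Cons a w)
  obtain x b where a: "a = (x, b)" by force
  let ?e = "if b then H_word x else inv_word (H_word x)"
  have run: "coset_run (False, False) ?e = (False, False)" by (cases x) auto
  have "reduce_word (rewrite_word (False, False) ?e) = reduce_word [a]"
    unfolding a by (cases x) (auto simp: reduce_word_def)
  then have "pres_equiv UNIV {} (rewrite_word (False, False) ?e) [a]"
    by (intro pres_equiv_if_reduce_word_eq) auto
  then have "pres_equiv UNIV {}
      (rewrite_word (False, False) ?e @ rewrite_word (False, False) (subst_word H_word w)) ([a] @ w)"
    using Cons by (intro pres_equiv_append) auto
  then show ?case using run Cons a by simp
qed

section \<open>The subgroup \<open>H\<close>\<close>

text \<open>The algebra is done for any group with this presentation and specialised to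
  \<open>forget_kernel P\<close> at the end.\<close>

locale kernel_presented_group = group +
  fixes s l m
  assumes presentation: "group_presentation G UNIV (gen_interp s l m) kernel_relations"
begin

abbreviation f :: "gen \<Rightarrow> 'a" where "f \<equiv> gen_interp s l m"

abbreviation h :: "gen \<Rightarrow> 'a" where "h \<equiv> \<lambda>x. word_val G f (H_word x)"

lemma f_closed: "range f \<subseteq> carrier G"
  using presentation by (simp add: group_presentation_def)

lemma gens_closed [simp]: "s \<in> carrier G" "l \<in> carrier G" "m \<in> carrier G"
  using f_closed gen_interp.simps by (metis range_subsetD)+

lemma h_closed: "range h \<subseteq> carrier G"
  using f_closed by (auto intro: word_val_closed)

lemma h_simps: "h Sigma = s" "h TauL = l \<otimes> inv s \<otimes> inv l" "h TauM = m \<otimes> s \<otimes> inv m"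
  by (simp_all add: m_assoc)

lemma word_val_f_eq: "word_val G f u = word_val G f v \<longleftrightarrow> pres_equiv UNIV kernel_relations u v"
  using presentation by (simp add: group_presentation_def)

lemma relations:
  "l \<otimes> inv s = s \<otimes> inv l"
  "m \<otimes> s = inv s \<otimes> inv m"
  "s \<otimes> s = inv m \<otimes> (inv l \<otimes> (m \<otimes> l))"
proof -
  have "word_val G f u = word_val G f v" if "(u, v) \<in> kernel_relations" for u v
    using that word_val_f_eq pres_equiv.relation by metis
  from this[of "[(TauL, True), (Sigma, False)]" "[(Sigma, True), (TauL, False)]"]
    this[of "[(TauM, True), (Sigma, True)]" "[(Sigma, False), (TauM, False)]"]
    this[of "[(Sigma, True), (Sigma, True)]" "[(TauM, False), (TauL, False), (TauM, True), (TauL, True)]"]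
  show "l \<otimes> inv s = s \<otimes> inv l" "m \<otimes> s = inv s \<otimes> inv m"
    "s \<otimes> s = inv m \<otimes> (inv l \<otimes> (m \<otimes> l))"
    by (simp_all add: kernel_relations_def)
qed

lemma subgroup_H_eq: "subgroup_H G s l m = generate G (range h)"
proof -
  have "x \<in> {Sigma, TauL, TauM}" for x by (cases x) auto
  then have U: "UNIV = {Sigma, TauL, TauM}" by (rule UNIV_eq_I)
  show ?thesis unfolding subgroup_H_def U image_insert image_empty h_simps ..
qed

text \<open>Together with \<open>m_assoc\<close> this makes the simplifier cancel inside
  right-nested products.\<close>

lemma cancel_left [simp]:
  assumes "x \<in> carrier G" "y \<in> carrier G"
  shows "x \<otimes> (inv x \<otimes> y) = y" "inv x \<otimes> (x \<otimes> y) = y"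
  using assms by (simp_all flip: m_assoc)

text \<open>Justifies the table: each entry, evaluated in \<open>h\<close>, is the Schreier
  generator it stands for.\<close>

lemma schreier_gen_value:
  "word_val G f (coset_rep q) \<otimes> f x
    = word_val G h (schreier_gen q x) \<otimes> word_val G f (coset_rep (coset_step q x))"
proof -
  have "inv l \<otimes> s = inv l \<otimes> (s \<otimes> inv l) \<otimes> l" by (simp add: m_assoc)
  then have ls: "inv l \<otimes> s = inv s \<otimes> l" by (simp add: m_assoc flip: relations(1))
  have "inv m \<otimes> inv s = inv m \<otimes> (inv s \<otimes> inv m) \<otimes> m" by (simp add: m_assoc)
  then have ms: "inv m \<otimes> inv s = s \<otimes> m" by (simp add: m_assoc flip: relations(2))
  have ml: "m \<otimes> l = l \<otimes> (m \<otimes> (s \<otimes> s))" by (simp add: relations(3))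
  \<comment> \<open>The entry for \<open>Sigma\<close> at \<open>(True, True)\<close>, shown to be
    the conjugate of \<open>s\<close> by \<open>l \<otimes> m\<close>; three of the cases reuse
    it.\<close>
  let ?A = "inv (h TauM) \<otimes> (inv s \<otimes> h TauL)"
  have "?A = m \<otimes> (inv s \<otimes> (inv m \<otimes> inv s)) \<otimes> (l \<otimes> (inv s \<otimes> inv l))"
    by (simp add: m_assoc inv_mult_group)
  also have "\<dots> = m \<otimes> (m \<otimes> l) \<otimes> (inv s \<otimes> inv l)" by (simp add: ms m_assoc)
  also have "\<dots> = m \<otimes> (l \<otimes> (m \<otimes> (s \<otimes> s))) \<otimes> (inv s \<otimes> inv l)" by (simp only: ml)
  also have "\<dots> = m \<otimes> l \<otimes> (m \<otimes> s) \<otimes> inv l" by (simp add: m_assoc)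
  also have "\<dots> = l \<otimes> (m \<otimes> (s \<otimes> (inv m \<otimes> inv l)))"
    unfolding ml relations(2) by (simp add: m_assoc)
  finally have A: "?A = l \<otimes> (m \<otimes> (s \<otimes> (inv m \<otimes> inv l)))" .
  \<comment> \<open>Lets \<open>h TauL\<close> and \<open>h TauM\<close> be treated as atoms where
    \<open>H_word.simps(2,3)\<close> are removed.\<close>
  have hc: "h TauL \<in> carrier G" "h TauM \<in> carrier G" using h_closed by blast+
  consider "q = (False, False)" | "q = (True, False)" | "q = (False, True)" | "q = (True, True)"
    by (cases q) auto
  then show ?thesis
  proof cases
    case 1
    then show ?thesis by (cases x) auto
  next
    case 2
    have "l \<otimes> l = inv (h TauL) \<otimes> s" by (simp add: inv_mult_group m_assoc ls)
    with 2 show ?thesis by (cases x) (simp_all add: inv_mult_group m_assoc)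
  next
    case 3
    show ?thesis
    proof (cases x)
      case Sigma
      with 3 show ?thesis by (simp add: m_assoc)
    next
      case TauL
      have "m \<otimes> l = ?A \<otimes> ?A \<otimes> (l \<otimes> m)" unfolding A by (simp add: m_assoc ml)
      with 3 TauL hc show ?thesis by (simp add: m_assoc del: H_word.simps(2,3))
    next
      case TauM
      have "m \<otimes> m = inv (h TauM) \<otimes> inv s" by (simp add: inv_mult_group m_assoc ms)
      with 3 TauM hc show ?thesis by (simp add: m_assoc del: H_word.simps(2,3))
    qed
  next
    case 4
    show ?thesis
    proof (cases x)
      case Sigma
      have "l \<otimes> m \<otimes> s = ?A \<otimes> (l \<otimes> m)" unfolding A by (simp add: m_assoc)
      with 4 Sigma hc show ?thesis by (simp add: m_assoc del: H_word.simps(2,3))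
    next
      case TauL
      \<comment> \<open>By \<open>ls\<close> the factor
        \<open>s \<otimes> (inv l \<otimes> s)\<close> is just \<open>l\<close>; this form exposes
        \<open>inv (h TauL)\<close>.\<close>
      have "l \<otimes> m \<otimes> l = l \<otimes> (s \<otimes> (inv l \<otimes> s)) \<otimes> (m \<otimes> (s \<otimes> s))"
        by (simp add: m_assoc ml ls)
      also have "\<dots> = inv (h TauL) \<otimes> (s \<otimes> (h TauM \<otimes> h TauM)) \<otimes> m"
        by (simp add: m_assoc inv_mult_group)
      finally show ?thesis using 4 TauL hc by (simp add: m_assoc del: H_word.simps(2,3))
    next
      case TauM
      \<comment> \<open>Here \<open>h TauL \<otimes> l\<close> equals
        \<open>l \<otimes> inv s\<close>, and \<open>ms\<close> absorbs the resulting
        \<open>inv m \<otimes> inv s\<close>.\<close>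
      have "l \<otimes> m \<otimes> m = inv ?A \<otimes> (h TauL \<otimes> l)"
        unfolding A by (simp add: m_assoc inv_mult_group ms)
      also have "\<dots> = inv (h TauL) \<otimes> (s \<otimes> (h TauM \<otimes> (h TauL \<otimes> l)))"
        using hc by (simp add: m_assoc inv_mult_group del: H_word.simps)
      finally show ?thesis using 4 TauM hc by (simp add: m_assoc del: H_word.simps(2,3))
    qed
  qed
qed

text \<open>The Schreier generators telescope along \<open>w\<close>. For a loop at the trivial
  coset both representatives are empty, so \<open>w\<close> and its rewriting have the same
  value.\<close>

lemma word_val_rewrite_word:
  "word_val G f (coset_rep q) \<otimes> word_val G f w
    = word_val G h (rewrite_word q w) \<otimes> word_val G f (coset_rep (coset_run q w))"
proof (induction w arbitrary: q)
  case Nil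
  show ?case using word_val_closed[OF f_closed] by simp
next
  case (Cons a w)
  obtain x b where a: "a = (x, b)" by force
  note [simp] = word_val_closed[OF f_closed] word_val_closed[OF h_closed]
    word_val_append[OF h_closed] word_val_inv_word[OF h_closed]
  have fx: "f x \<in> carrier G" using f_closed by blast
  let ?r = "\<lambda>q. word_val G f (coset_rep q)" and ?q = "coset_step q x"
  let ?y = "if b then schreier_gen q x else inv_word (schreier_gen ?q x)"
  have "?r q \<otimes> word_val G f [a] = word_val G h ?y \<otimes> ?r ?q"
  proof (cases b)
    case True
    then show ?thesis using schreier_gen_value[of q x] fx a by simp
  next
    case False
    \<comment> \<open>The table identity at \<open>?q\<close>, whose step leads back to
      \<open>q\<close>, solved for the representative of \<open>q\<close>.\<close>
    have "?r q = inv (word_val G h (schreier_gen ?q x)) \<otimes> (?r ?q \<otimes> f x)"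
      using schreier_gen_value[of ?q x] by simp
    with False show ?thesis using fx a by (simp add: m_assoc)
  qed
  then have "?r q \<otimes> word_val G f (a # w) = word_val G h ?y \<otimes> (?r ?q \<otimes> word_val G f w)"
    using word_val_append[OF f_closed, of "[a]" w] by (simp flip: m_assoc)
  also have "\<dots> = word_val G h (rewrite_word q (a # w)) \<otimes> ?r (coset_run q (a # w))"
    unfolding Cons.IH using a by (simp add: m_assoc)
  finally show ?case .
qed

text \<open>Elements of the subgroup are values of substituted words, which end at the trivial
  coset, and the final coset depends only on the value. Conversely, a word ending there equals its
  rewriting in \<open>h\<close>.\<close>

lemma word_val_in_subgroup_H:
  "word_val G f w \<in> subgroup_H G s l m \<longleftrightarrow> even (exp_sum TauL w) \<and> even (exp_sum TauM w)"
proof -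
  have H: "subgroup_H G s l m = range (word_val G h)"
    using generate_eq_word_val[OF h_closed] by (simp add: subgroup_H_eq words_def)
  have "word_val G f w \<in> subgroup_H G s l m \<longleftrightarrow> coset_run (False, False) w = (False, False)"
  proof
    assume "word_val G f w \<in> subgroup_H G s l m"
    then obtain v where "word_val G f w = word_val G f (subst_word H_word v)"
      unfolding H word_val_subst_word[OF f_closed] by blast
    then show "coset_run (False, False) w = (False, False)"
      using rewrite_word_pres_equiv rewrite_subst_H_word by (metis word_val_f_eq)
  next
    assume "coset_run (False, False) w = (False, False)"
    then have "word_val G f w = word_val G h (rewrite_word (False, False) w)"
      using word_val_rewrite_word[of "(False, False)" w]
      by (simp add: word_val_closed[OF f_closed] word_val_closed[OF h_closed])
    then show "word_val G f w \<in> subgroup_H G s l m" using H by simp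
  qed
  then show ?thesis by (simp add: coset_run_eq)
qed

text \<open>Equal values in \<open>h\<close> make the substituted words equivalent; rewriting them
  recovers \<open>u\<close> and \<open>v\<close> up to free cancellation.\<close>

lemma free_group_subgroup_H: "free_group (G\<lparr>carrier := subgroup_H G s l m\<rparr>)"
proof -
  let ?H = "subgroup_H G s l m"
  have sub: "subgroup ?H G" unfolding subgroup_H_eq using h_closed by (rule generate_is_subgroup)
  have h: "range h \<subseteq> ?H" unfolding subgroup_H_eq by (auto intro: generate.incl)
  have "word_val G h u = word_val G h v \<longleftrightarrow> pres_equiv UNIV {} u v" for u v
  proof
    assume "word_val G h u = word_val G h v"
    then have "pres_equiv UNIV {} (rewrite_word (False, False) (subst_word H_word u))
        (rewrite_word (False, False) (subst_word H_word v))"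
      using rewrite_word_pres_equiv word_val_f_eq word_val_subst_word[OF f_closed] by metis
    then show "pres_equiv UNIV {} u v"
      using rewrite_subst_H_word by (metis pres_equiv.sym pres_equiv.trans)
  next
    assume "pres_equiv UNIV {} u v"
    then show "word_val G h u = word_val G h v" using h_closed by (rule word_val_pres_equiv)
  qed
  moreover have "generate (G\<lparr>carrier := ?H\<rparr>) (range h) = ?H"
    using generate_consistent[OF h sub] by (simp add: subgroup_H_eq)
  ultimately have "group_presentation (G\<lparr>carrier := ?H\<rparr>) UNIV h {}"
    using h subgroup_imp_group[OF sub] by (simp add: group_presentation_def word_val_subgroup[OF sub h])
  then show ?thesis by (rule free_group_if_presentation)
qed

end

theorem lemma4p2:
  fixes P :: "(complex \<times> complex) set"
    and \<sigma> \<tau>\<^sub>l \<tau>\<^sub>m :: "(complex \<times> complex \<Rightarrow> complex \<times> complex) set"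
  assumes "P \<subseteq> topspace torus" and "card P = 2"
    and "group_presentation (forget_kernel P) UNIV (gen_interp \<sigma> \<tau>\<^sub>l \<tau>\<^sub>m) kernel_relations"
  shows "(\<forall>w :: gen word.
            word_val (forget_kernel P) (gen_interp \<sigma> \<tau>\<^sub>l \<tau>\<^sub>m) w \<in> subgroup_H (forget_kernel P) \<sigma> \<tau>\<^sub>l \<tau>\<^sub>m
              \<longleftrightarrow> even (exp_sum TauL w) \<and> even (exp_sum TauM w))
       \<and> free_group ((forget_kernel P)\<lparr>carrier := subgroup_H (forget_kernel P) \<sigma> \<tau>\<^sub>l \<tau>\<^sub>m\<rparr>)"
proof -
  interpret kernel_presented_group "forget_kernel P" \<sigma> \<tau>\<^sub>l \<tau>\<^sub>m
    using assms(3)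
    by (auto simp: kernel_presented_group_def kernel_presented_group_axioms_def group_presentation_def)
  show ?thesis using word_val_in_subgroup_H free_group_subgroup_H by blast
qed

end
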